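(* Let $K$ be an augmented directed complex with a unitary loop-free basis $B$. Let $a=\sum_{i=0}^m b_i+r_{|a|_c}(a)$ be a coherent chain of composition degree $|a|_c\ge0$, written in ordered form. For $0\le k\le m$ put $$\beta_k:=b_k+\Big(d_{|a|_c}^-\big(\textstyle\sum_{i<k}b_i\big)\setminus d_{|a|_c}^+b_k\Big)\vee\Big(d_{|a|_c}^+\big(\textstyle\sum_{k<i\le m}b_i\big)\setminus d_{|a|_c}^-b_k\Big)+r_{|a|_c}(a)$$ (empty sums being $0$), where for chains $x,y$ the chain $x\setminus y$ is the truncated difference, with coefficients $\max(\lambda_b^x-\lambda_b^y,0)$. Then the $\beta_k$ are coherent chains, $d_{|a|_c}^-\beta_k=d_{|a|_c}^+\beta_{k+1}$ for $0\le k<m$, and in the $\omega$-category $\mu K$ of coherent chains $$a=\beta_0*_{|a|_c}\beta_1*_{|a|_c}\cdots*_{|a|_c}\beta_m .$$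
   Context: **Augmented directed complexes.** An augmented directed complex $K$ is a chain complex of abelian groups $K_0\xleftarrow{\partial_0}K_1\xleftarrow{\partial_1}K_2\leftarrow\cdots$ with an augmentation $e:K_0\to\mathbb Z$ ($e\partial_0=0$) and submonoids $K_n^*\subset K_n$. A basis of $K$ is a graded set $B=(B_n)$ such that $B_n$ is a basis of the monoid $K_n^*$ and of the group $K_n$; $|b|$ denotes the degree of $b\in B$. For $x=\sum_b\lambda_bb$: $(x)_+=\sum_{\lambda_b>0}\lambda_bb$, $(x)_-=\sum_{\lambda_b<0}-\lambda_bb$, and $\partial_n^\pm(x)=(\partial_nx)_\pm$. For $a\in K_n^*$, $\alpha\in\{-,+\}$: $\langle a\rangle_n^\alpha=a$ and $\langle a\rangle_k^\alpha=\partial_k^\alpha\langle a\rangle_{k+1}^\alpha$ for $k<n$. The basis is unitary if $e(\langle b\rangle_0^-)=e(\langle b\rangle_0^+)=1$ for all $b\in B$. Let $\odot_n$ be the smallest reflexive transitive relation on $B$ with $a\odot_nb$ whenever $|a|,|b|\ge n$ and $\langle a\rangle_n^-\wedge\langle b\rangle_n^+\ne0$; the basis is loop-free if every $\odot_n$ is a partial order. **Chains.** A chain is a formal finite sum $a=\sum_{b\in B}\lambda_b^ab$ with $\lambda_b^a\in\mathbb N$ (different degrees allowed); its support is $\{b:\lambda_b^a\ne0\}$ and $|a|$ is the maximal degree of elements of the support ($|0|=-1$). $\wedge,\vee$ are coefficientwise min and max, and $a\setminus a'$ has coefficients $\max(\lambda_b^a-\lambda_b^{a'},0)$. $(a)_k$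 is the part of $a$ of degree exactly $k$, $r_k(a)$ the part of degree $\le k$. For $\alpha\in\{-,+\}$, $d_n^\alpha(a)=a$ if $|a|\le n$ and $d_n^\alpha(a)=\partial_n^\alpha((d_{n+1}^\alpha a)_{n+1})+r_n(d_{n+1}^\alpha a)$ otherwise. One has $e(d_0^+a)=e(d_0^-a)$; $a$ is coherent if this equals $1$. The composition degree $|a|_c$ is the supremum of the $n\in\mathbb N\cup\{-1\}$ such that there are distinct $b,b'$ in the support of $a$ with $|b|\ge|b'|>n$ (and $-1$ if there is none). An ordered form of $a$ is an expression $a=\sum_{i=0}^m\lambda_ib_i+r_{|a|_c}(a)$ where $\lambda_i>0$ and $b_0,\dots,b_m$ are the distinct elements of the support of degree $>|a|_c$, enumerated so that $b_j\odot_{|a|_c}b_i$ never holds for $i<j$. (For coherent chains all coefficients equal $1$.) **$\mu K$.** The $\omega$-category $\mu K$ has as $n$-cells the coherent chains of degree $\le n$, with sources and targets $d_k^\pm$, and for $d_k^-(a)=d_k^+(a')=c$ the composite is $a*_ka'=(a-c+a')_+$. *)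

theory Defs
  imports "HOL-Algebra.Elementary_Groups" "HOL-Library.Multiset" "HOL-Library.Poly_Mapping"
    "HOL-Algebra.FiniteProduct"
begin

section \<open>Augmented directed complexes\<close>

text \<open>The groups of a complex are commutative groups in the sense of HOL-Algebra, hence written
  multiplicatively. \<open>bdry K n\<close> is the boundary from degree \<open>n + 1\<close> to degree \<open>n\<close>.\<close>

record 'a adc =
  grp :: "nat \<Rightarrow> 'a monoid"
  bdry :: "nat \<Rightarrow> 'a \<Rightarrow> 'a"
  aug :: "'a \<Rightarrow> int"
  pos :: "nat \<Rightarrow> 'a set"

definition augmented_directed_complex :: "'a adc \<Rightarrow> bool" where
  "augmented_directed_complex K \<longleftrightarrow>
     (\<forall>n. comm_group (grp K n)) \<and>
     (\<forall>n. bdry K n \<in> hom (grp K (Suc n)) (grp K n)) \<and>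
     (\<forall>n. \<forall>x\<in>carrier (grp K (Suc (Suc n))). bdry K n (bdry K (Suc n) x) = \<one>\<^bsub>grp K n\<^esub>) \<and>
     aug K \<in> hom (grp K 0) integer_group \<and>
     (\<forall>x\<in>carrier (grp K (Suc 0)). aug K (bdry K 0 x) = 0) \<and>
     (\<forall>n. submonoid (pos K n) (grp K n))"

definition int_comb :: "'a monoid \<Rightarrow> ('a \<Rightarrow>\<^sub>0 int) \<Rightarrow> 'a" where
  "int_comb G f = finprod G (\<lambda>b. b [^]\<^bsub>G\<^esub> Poly_Mapping.lookup f b) (Poly_Mapping.keys f)"

definition nat_comb :: "'a monoid \<Rightarrow> 'a multiset \<Rightarrow> 'a" where
  "nat_comb G c = finprod G (\<lambda>b. b [^]\<^bsub>G\<^esub> count c b) (set_mset c)"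

definition group_basis :: "'a monoid \<Rightarrow> 'a set \<Rightarrow> bool" where
  "group_basis G S \<longleftrightarrow> S \<subseteq> carrier G \<and>
     (\<forall>x\<in>carrier G. \<exists>!f. Poly_Mapping.keys f \<subseteq> S \<and> int_comb G f = x)"

definition submonoid_basis :: "'a monoid \<Rightarrow> 'a set \<Rightarrow> 'a set \<Rightarrow> bool" where
  "submonoid_basis G M S \<longleftrightarrow> S \<subseteq> M \<and>
     (\<forall>x\<in>M. \<exists>!c. set_mset c \<subseteq> S \<and> nat_comb G c = x)"

definition adc_basis :: "'a adc \<Rightarrow> (nat \<Rightarrow> 'a set) \<Rightarrow> bool" where
  "adc_basis K B \<longleftrightarrow>
     (\<forall>n. submonoid_basis (grp K n) (pos K n) (B n) \<and> group_basis (grp K n) (B n))"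

definition coords :: "'a monoid \<Rightarrow> 'a set \<Rightarrow> 'a \<Rightarrow> ('a \<Rightarrow>\<^sub>0 int)" where
  "coords G S x = (THE f. Poly_Mapping.keys f \<subseteq> S \<and> int_comb G f = x)"


section \<open>Chains\<close>

text \<open>A basis element carries its degree as first component, so that the \<open>B n\<close> need not be disjoint
  as sets. A chain is a finite multiset of basis elements; the coefficient of \<open>b\<close> in \<open>a\<close> is
  \<open>count a b\<close>, so that \<open>\<inter>#\<close>, \<open>\<union>#\<close> and the subtraction of multisets are the coefficientwise minimum,
  maximum and truncated difference. An element of the free monoid \<open>pos K n\<close> is represented by the
  corresponding chain that is homogeneous of degree \<open>n\<close>.\<close>

type_synonym 'a chain = "(nat \<times> 'a) multiset"

definition gens :: "(nat \<Rightarrow> 'a set) \<Rightarrow> (nat \<times> 'a) set" where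
  "gens B = Sigma UNIV B"

definition is_chain :: "(nat \<Rightarrow> 'a set) \<Rightarrow> 'a chain \<Rightarrow> bool" where
  "is_chain B a \<longleftrightarrow> set_mset a \<subseteq> gens B"

definition deg :: "'a chain \<Rightarrow> int" where
  "deg a = (if a = {#} then - 1 else Max ((\<lambda>b. int (fst b)) ` set_mset a))"

definition homog_part :: "nat \<Rightarrow> 'a chain \<Rightarrow> 'a chain" where
  "homog_part k a = {#b \<in># a. fst b = k#}"

definition low_part :: "int \<Rightarrow> 'a chain \<Rightarrow> 'a chain" where
  "low_part k a = {#b \<in># a. int (fst b) \<le> k#}"

datatype sign = Minus | Plus

fun signed :: "sign \<Rightarrow> int \<Rightarrow> int" where
  "signed Plus z = z"
| "signed Minus z = - z"

text \<open>\<open>signed_part \<alpha> G S x\<close> is $(x)_\alpha$, as a multiset; \<open>nat\<close> discards the coefficients of the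
  other sign.\<close>

definition signed_part :: "sign \<Rightarrow> 'a monoid \<Rightarrow> 'a set \<Rightarrow> 'a \<Rightarrow> 'a multiset" where
  "signed_part \<alpha> G S x =
     (\<Sum>b\<in>Poly_Mapping.keys (coords G S x).
        replicate_mset (nat (signed \<alpha> (Poly_Mapping.lookup (coords G S x) b))) b)"

definition elem_of :: "'a adc \<Rightarrow> nat \<Rightarrow> 'a chain \<Rightarrow> 'a" where
  "elem_of K n c = nat_comb (grp K n) (image_mset snd c)"

text \<open>The operation $\partial_n^\alpha$, from chains homogeneous of degree \<open>n + 1\<close> to chains
  homogeneous of degree \<open>n\<close>.\<close>

definition signed_bdry ::
    "'a adc \<Rightarrow> (nat \<Rightarrow> 'a set) \<Rightarrow> sign \<Rightarrow> nat \<Rightarrow> 'a chain \<Rightarrow> 'a chain" where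
  "signed_bdry K B \<alpha> n c =
     image_mset (Pair n) (signed_part \<alpha> (grp K n) (B n) (bdry K n (elem_of K (Suc n) c)))"

text \<open>\<open>atom_face K B \<alpha> n k a\<close> is $\langle a\rangle_k^\alpha$ for \<open>a\<close> homogeneous of degree \<open>n\<close> and \<open>k \<le> n\<close>.\<close>

function atom_face ::
    "'a adc \<Rightarrow> (nat \<Rightarrow> 'a set) \<Rightarrow> sign \<Rightarrow> nat \<Rightarrow> nat \<Rightarrow> 'a chain \<Rightarrow> 'a chain" where
  "atom_face K B \<alpha> n k a =
     (if k < n then signed_bdry K B \<alpha> k (atom_face K B \<alpha> n (Suc k) a) else a)"
  by pat_completeness auto
termination
  by (relation "measure (\<lambda>(K, B, \<alpha>, n, k, a). n - k)") auto

declare atom_face.simps [simp del]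

abbreviation gen_face ::
    "'a adc \<Rightarrow> (nat \<Rightarrow> 'a set) \<Rightarrow> sign \<Rightarrow> nat \<Rightarrow> nat \<times> 'a \<Rightarrow> 'a chain" where
  "gen_face K B \<alpha> k b \<equiv> atom_face K B \<alpha> (fst b) k {#b#}"

definition unitary :: "'a adc \<Rightarrow> (nat \<Rightarrow> 'a set) \<Rightarrow> bool" where
  "unitary K B \<longleftrightarrow> (\<forall>b\<in>gens B. \<forall>\<alpha>. aug K (elem_of K 0 (gen_face K B \<alpha> 0 b)) = 1)"

inductive_set odot :: "'a adc \<Rightarrow> (nat \<Rightarrow> 'a set) \<Rightarrow> nat \<Rightarrow> ((nat \<times> 'a) \<times> (nat \<times> 'a)) set"
  for K :: "'a adc" and B :: "nat \<Rightarrow> 'a set" and n :: nat where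
  refl: "a \<in> gens B \<Longrightarrow> (a, a) \<in> odot K B n"
| base: "\<lbrakk>a \<in> gens B; b \<in> gens B; n \<le> fst a; n \<le> fst b;
    gen_face K B Minus n a \<inter># gen_face K B Plus n b \<noteq> {#}\<rbrakk> \<Longrightarrow> (a, b) \<in> odot K B n"
| trans: "\<lbrakk>(a, b) \<in> odot K B n; (b, c) \<in> odot K B n\<rbrakk> \<Longrightarrow> (a, c) \<in> odot K B n"

definition loop_free :: "'a adc \<Rightarrow> (nat \<Rightarrow> 'a set) \<Rightarrow> bool" where
  "loop_free K B \<longleftrightarrow> (\<forall>n. partial_order_on (gens B) (odot K B n))"

function chain_face ::
    "'a adc \<Rightarrow> (nat \<Rightarrow> 'a set) \<Rightarrow> sign \<Rightarrow> nat \<Rightarrow> 'a chain \<Rightarrow> 'a chain" where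
  "chain_face K B \<alpha> n a =
     (if deg a \<le> int n then a
      else signed_bdry K B \<alpha> n (homog_part (Suc n) (chain_face K B \<alpha> (Suc n) a))
           + low_part (int n) (chain_face K B \<alpha> (Suc n) a))"
  by pat_completeness auto
termination
  by (relation "measure (\<lambda>(K, B, \<alpha>, n, a). nat (deg a - int n))") auto

declare chain_face.simps [simp del]

definition coherent :: "'a adc \<Rightarrow> (nat \<Rightarrow> 'a set) \<Rightarrow> 'a chain \<Rightarrow> bool" where
  "coherent K B a \<longleftrightarrow> is_chain B a \<and> (\<forall>\<alpha>. aug K (elem_of K 0 (chain_face K B \<alpha> 0 a)) = 1)"

definition comp_deg :: "'a chain \<Rightarrow> int" where
  "comp_deg a = Sup (insert (- 1)
     {n. n \<ge> - 1 \<and> (\<exists>b\<in>set_mset a. \<exists>b'\<in>set_mset a. b \<noteq> b' \<and> fst b \<ge> fst b' \<and> int (fst b') > n)})"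

text \<open>\<open>odot\<close> is indexed by naturals, whence \<open>nat\<close> in the last clause: ordered forms are only
  considered for chains with \<open>comp_deg a \<ge> 0\<close>.\<close>

definition ordered_form ::
    "'a adc \<Rightarrow> (nat \<Rightarrow> 'a set) \<Rightarrow> 'a chain \<Rightarrow> nat \<Rightarrow> (nat \<Rightarrow> nat) \<Rightarrow> (nat \<Rightarrow> nat \<times> 'a) \<Rightarrow> bool" where
  "ordered_form K B a m l b \<longleftrightarrow>
     a = (\<Sum>i=0..m. replicate_mset (l i) (b i)) + low_part (comp_deg a) a \<and>
     (\<forall>i\<le>m. l i > 0) \<and>
     bij_betw b {0..m} {x \<in> set_mset a. int (fst x) > comp_deg a} \<and>
     (\<forall>i j. i < j \<longrightarrow> j \<le> m \<longrightarrow> (b j, b i) \<notin> odot K B (nat (comp_deg a)))"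


section \<open>The \<open>\<omega>\<close>-category of coherent chains\<close>

definition mu_cells :: "'a adc \<Rightarrow> (nat \<Rightarrow> 'a set) \<Rightarrow> nat \<Rightarrow> 'a chain set" where
  "mu_cells K B n = {a. coherent K B a \<and> deg a \<le> int n}"

text \<open>Composition is partial. As all coefficients are natural numbers, the truncated difference
  \<open>(a + a') - c\<close> is the positive part $(a - c + a')_+$.\<close>

definition mu_comp ::
    "'a adc \<Rightarrow> (nat \<Rightarrow> 'a set) \<Rightarrow> nat \<Rightarrow> 'a chain \<Rightarrow> 'a chain \<Rightarrow> 'a chain option" where
  "mu_comp K B k a a' =
     (if a \<in> (\<Union>n. mu_cells K B n) \<and> a' \<in> (\<Union>n. mu_cells K B n) \<and>
         chain_face K B Minus k a = chain_face K B Plus k a'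
      then Some ((a + a') - chain_face K B Minus k a) else None)"

text \<open>\<open>mu_composite K B k x m\<close> is the left-bracketed composite $x_0 *_k x_1 *_k \cdots *_k x_m$;
  it is \<open>None\<close> as soon as one of the composites involved is undefined.\<close>

primrec mu_composite ::
    "'a adc \<Rightarrow> (nat \<Rightarrow> 'a set) \<Rightarrow> nat \<Rightarrow> (nat \<Rightarrow> 'a chain) \<Rightarrow> nat \<Rightarrow> 'a chain option" where
  "mu_composite K B k x 0 = (if x 0 \<in> (\<Union>n. mu_cells K B n) then Some (x 0) else None)"
| "mu_composite K B k x (Suc m) =
     Option.bind (mu_composite K B k x m) (\<lambda>y. mu_comp K B k y (x (Suc m)))"

end

theory Submission
  imports Defs
begin

text \<open>Write \<open>face_coeff n c\<close> for the integer vector that is the difference of the degree \<open>n\<close>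
  parts of \<open>d_n^+ c\<close> and \<open>d_n^- c\<close> (a boundary); it is additive on the generators
  \<open>b_0, \<dots>, b_m\<close> because at most one of them has degree above \<open>n + 1\<close>. Fix a basis element \<open>x\<close>
  of degree \<open>n\<close>. By the ordering, every \<open>b_i\<close> with \<open>x\<close> in its source comes before every \<open>b_j\<close>
  with \<open>x\<close> in its target. An identity between integers then shows that the faces of \<open>\<beta>_k\<close> are the
  consecutive levels obtained from \<open>d_n^+ a\<close> by subtracting the vectors of \<open>b_0, b_1, \<dots>\<close> in
  turn, so the slices are composable; coherence propagates along them because \<open>e \<circ> d_0\<close> is
  unchanged by taking faces. The composite of \<open>\<beta>_0, \<dots>, \<beta>_k\<close> has as degree \<open>n\<close> part the minimum
  of the first and last level; for this the levels must be free of multiplicities, which is proved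
  by slicing one dimension lower.\<close>

section \<open>Bases of commutative groups\<close>

locale comm_group_basis = comm_group G for G :: "'a monoid" (structure) +
  fixes S :: "'a set"
  assumes basis: "group_basis G S"
begin

lemma basis_carrier: "S \<subseteq> carrier G"
  using basis by (auto simp: group_basis_def)

lemma nat_comb_superset:
  assumes "finite A" "set_mset c \<subseteq> A" "A \<subseteq> carrier G"
  shows "nat_comb G c = finprod G (\<lambda>b. b [^] count c b) A"
  unfolding nat_comb_def
  by (rule finprod_mono_neutral_cong_left) (use assms in \<open>auto simp: not_in_iff\<close>)

lemma int_comb_superset:
  assumes "finite A" "Poly_Mapping.keys f \<subseteq> A" "A \<subseteq> carrier G"
  shows "int_comb G f = finprod G (\<lambda>b. b [^] Poly_Mapping.lookup f b) A"
  unfolding int_comb_def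
  by (rule finprod_mono_neutral_cong_left) (use assms in \<open>auto simp: in_keys_iff\<close>)

lemma nat_comb_closed: "set_mset c \<subseteq> carrier G \<Longrightarrow> nat_comb G c \<in> carrier G"
  unfolding nat_comb_def by (rule finprod_closed) auto

lemma nat_comb_empty: "nat_comb G {#} = \<one>"
  by (simp add: nat_comb_def)

lemma nat_comb_add:
  assumes "set_mset c \<subseteq> carrier G" "set_mset c' \<subseteq> carrier G"
  shows "nat_comb G (c + c') = nat_comb G c \<otimes> nat_comb G c'"
proof -
  let ?A = "set_mset c \<union> set_mset c'"
  have A: "finite ?A" "?A \<subseteq> carrier G"
    using assms by auto
  have "nat_comb G (c + c') = finprod G (\<lambda>b. b [^] count c b \<otimes> b [^] count c' b) ?A"
    by (subst nat_comb_superset[OF A(1) _ A(2)])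
      (use assms in \<open>auto simp: nat_pow_mult[OF subsetD[OF A(2)]] simp_implies_def
        intro!: finprod_cong\<close>)
  also have "\<dots> = nat_comb G c \<otimes> nat_comb G c'"
    by (subst finprod_multf) (use A in \<open>auto simp: nat_comb_superset[of ?A]\<close>)
  finally show ?thesis .
qed

lemma int_comb_add:
  assumes "Poly_Mapping.keys f \<subseteq> carrier G" "Poly_Mapping.keys g \<subseteq> carrier G"
  shows "int_comb G (f + g) = int_comb G f \<otimes> int_comb G g"
proof -
  let ?A = "Poly_Mapping.keys f \<union> Poly_Mapping.keys g"
  have A: "finite ?A" "?A \<subseteq> carrier G"
    using assms by auto
  have "int_comb G (f + g) =
      finprod G (\<lambda>b. b [^] Poly_Mapping.lookup f b \<otimes> b [^] Poly_Mapping.lookup g b) ?A"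
    by (subst int_comb_superset[OF A(1) _ A(2)])
      (use assms keys_add[of f g] in \<open>auto simp: int_pow_mult[OF subsetD[OF A(2)]] lookup_add
        simp_implies_def intro!: finprod_cong\<close>)
  also have "\<dots> = int_comb G f \<otimes> int_comb G g"
    by (subst finprod_multf) (use A in \<open>auto simp: int_comb_superset[of ?A]\<close>)
  finally show ?thesis .
qed

lemma coords_unique:
  assumes "x \<in> carrier G" "Poly_Mapping.keys f \<subseteq> S" "int_comb G f = x"
  shows "coords G S x = f"
  unfolding coords_def
  by (rule the1_equality) (use assms basis in \<open>auto simp: group_basis_def\<close>)

lemma coords_spec:
  assumes "x \<in> carrier G"
  shows "Poly_Mapping.keys (coords G S x) \<subseteq> S" "int_comb G (coords G S x) = x"
proof -
  have "\<exists>!f. Poly_Mapping.keys f \<subseteq> S \<and> int_comb G f = x"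
    using assms basis by (auto simp: group_basis_def)
  from theI'[OF this] show "Poly_Mapping.keys (coords G S x) \<subseteq> S" "int_comb G (coords G S x) = x"
    unfolding coords_def by auto
qed

lemma coords_mult:
  assumes x: "x \<in> carrier G" and y: "y \<in> carrier G"
  shows "coords G S (x \<otimes> y) = coords G S x + coords G S y"
proof (rule coords_unique)
  note sx = coords_spec[OF x] and sy = coords_spec[OF y]
  show "int_comb G (coords G S x + coords G S y) = x \<otimes> y"
    using sx sy basis_carrier by (subst int_comb_add) auto
  show "Poly_Mapping.keys (coords G S x + coords G S y) \<subseteq> S"
    using keys_add[of "coords G S x" "coords G S y"] sx(1) sy(1) by blast
qed (use x y in simp)

lemma coords_one: "coords G S \<one> = 0"
  by (rule coords_unique) (auto simp: int_comb_def)

end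

lemma count_signed_part:
  "count (signed_part \<alpha> G S x) y = nat (signed \<alpha> (Poly_Mapping.lookup (coords G S x) y))"
  by (cases \<alpha>; cases "y \<in> Poly_Mapping.keys (coords G S x)")
    (auto simp: signed_part_def count_sum in_keys_iff)

context comm_group_basis
begin

lemma set_signed_part:
  assumes "x \<in> carrier G"
  shows "set_mset (signed_part \<alpha> G S x) \<subseteq> Poly_Mapping.keys (coords G S x)"
  by (cases \<alpha>) (auto simp: count_signed_part in_keys_iff simp flip: count_greater_zero_iff)

text \<open>Coefficientwise this is \<open>nat k = nat (- k) + k\<close> for integers
  \<open>k\<close>. Keeping inverses out lets both signed parts remain natural combinations, to
  which homomorphisms are then applied.\<close>

lemma nat_comb_signed_parts:
  assumes x: "x \<in> carrier G"
  shows "nat_comb G (signed_part Plus G S x) = nat_comb G (signed_part Minus G S x) \<otimes> x"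
proof -
  let ?f = "coords G S x"
  let ?A = "Poly_Mapping.keys ?f"
  note s = coords_spec[OF x]
  have A: "finite ?A" "?A \<subseteq> carrier G"
    using s basis_carrier by auto
  have pow: "b [^] nat k = b [^] nat (- k) \<otimes> b [^] k" if "b \<in> carrier G" for b and k :: int
  proof -
    have "b [^] nat (- k) \<otimes> b [^] k = b [^] (int (nat (- k)) + k)"
      using that by (simp add: int_pow_mult int_pow_int)
    also have "int (nat (- k)) + k = int (nat k)"
      by simp
    finally show ?thesis
      by (simp only: int_pow_int)
  qed
  have "nat_comb G (signed_part Plus G S x) = finprod G (\<lambda>b. b [^] nat (Poly_Mapping.lookup ?f b)) ?A"
    by (subst nat_comb_superset[OF A(1) set_signed_part[OF x] A(2)]) (simp add: count_signed_part)
  also have "\<dots> = finprod G (\<lambda>b. b [^] nat (- Poly_Mapping.lookup ?f b) \<otimes>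
      b [^] Poly_Mapping.lookup ?f b) ?A"
    using A by (intro finprod_cong) (auto intro!: pow simp: simp_implies_def)
  also have "\<dots> = finprod G (\<lambda>b. b [^] nat (- Poly_Mapping.lookup ?f b)) ?A \<otimes> int_comb G ?f"
    using A by (subst finprod_multf) (auto simp: int_comb_def)
  also have "finprod G (\<lambda>b. b [^] nat (- Poly_Mapping.lookup ?f b)) ?A =
      nat_comb G (signed_part Minus G S x)"
    by (subst nat_comb_superset[OF A(1) set_signed_part[OF x] A(2)]) (simp add: count_signed_part)
  finally show ?thesis
    using s by simp
qed

end

section \<open>Faces of chains\<close>

lemma deg_le_iff: "deg a \<le> int n \<longleftrightarrow> (\<forall>b\<in>#a. fst b \<le> n)"
  by (auto simp: deg_def)

lemma deg_le_Suc: "deg a \<le> int n \<Longrightarrow> deg a \<le> int (Suc n)"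
  by simp

lemma is_chain_add [simp]: "is_chain B (a + b) \<longleftrightarrow> is_chain B a \<and> is_chain B b"
  and is_chain_empty [simp]: "is_chain B {#}"
  and is_chain_add_mset [simp]: "is_chain B (add_mset x a) \<longleftrightarrow> x \<in> gens B \<and> is_chain B a"
  and is_chain_subset: "is_chain B a \<Longrightarrow> c \<subseteq># a \<Longrightarrow> is_chain B c"
  by (auto simp: is_chain_def dest: mset_subset_eqD)

lemma is_chain_union: "is_chain B a \<Longrightarrow> is_chain B c \<Longrightarrow> is_chain B (a \<union># c)"
  by (auto simp: is_chain_def)

lemma is_chain_homog_part: "is_chain B a \<Longrightarrow> is_chain B (homog_part n a)"
  and is_chain_low_part: "is_chain B a \<Longrightarrow> is_chain B (low_part k a)"
  by (auto simp: is_chain_def homog_part_def low_part_def)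

lemma is_chain_sum: "(\<And>i. i \<in> I \<Longrightarrow> is_chain B (f i)) \<Longrightarrow> is_chain B (\<Sum>i\<in>I. f i)"
  by (induction I rule: infinite_finite_induct) auto

lemma count_homog_part: "count (homog_part n a) (j, x) = (if j = n then count a (j, x) else 0)"
  and count_low_part: "count (low_part k a) (j, x) = (if int j \<le> k then count a (j, x) else 0)"
  by (auto simp: homog_part_def low_part_def)

lemma homog_part_above_deg: "deg a \<le> int n \<Longrightarrow> homog_part (Suc n) a = {#}"
  and low_part_deg: "deg a \<le> int n \<Longrightarrow> low_part (int n) a = a"
  by (auto simp: deg_le_iff homog_part_def low_part_def filter_mset_eq_conv)

lemma homog_part_add: "homog_part n (a + c) = homog_part n a + homog_part n c"
  and low_part_add: "low_part k (a + c) = low_part k a + low_part k c"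
  by (simp_all add: homog_part_def low_part_def)

definition homogeneous :: "(nat \<Rightarrow> 'a set) \<Rightarrow> nat \<Rightarrow> 'a chain \<Rightarrow> bool" where
  "homogeneous B n c \<longleftrightarrow> is_chain B c \<and> (\<forall>b\<in>#c. fst b = n)"

lemma homogeneous_homog_part: "is_chain B a \<Longrightarrow> homogeneous B n (homog_part n a)"
  by (auto simp: homogeneous_def is_chain_homog_part) (auto simp: homog_part_def)

lemma chain_eqI: "(\<And>j x. count a (j, x) = count b (j, x)) \<Longrightarrow> a = b" for a b :: "'a chain"
  by (rule multiset_eqI) auto

locale based_adc =
  fixes K :: "'a adc" and B :: "nat \<Rightarrow> 'a set"
  assumes complex: "augmented_directed_complex K" and basis: "adc_basis K B"
begin

sublocale grp: comm_group_basis "grp K n" "B n" for n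
  using complex basis
  by (auto simp: comm_group_basis_def comm_group_basis_axioms_def augmented_directed_complex_def
      adc_basis_def)

section \<open>Boundaries in coordinates\<close>

lemma bdry_hom: "bdry K n \<in> hom (grp K (Suc n)) (grp K n)"
  and bdry_bdry: "x \<in> carrier (grp K (Suc (Suc n))) \<Longrightarrow> bdry K n (bdry K (Suc n) x) = \<one>\<^bsub>grp K n\<^esub>"
  and aug_hom: "aug K \<in> hom (grp K 0) integer_group"
  and aug_bdry: "y \<in> carrier (grp K (Suc 0)) \<Longrightarrow> aug K (bdry K 0 y) = 0"
  using complex by (auto simp: augmented_directed_complex_def)

lemma bdry_closed [simp]: "x \<in> carrier (grp K (Suc n)) \<Longrightarrow> bdry K n x \<in> carrier (grp K n)"
  using bdry_hom[of n] by (auto simp: hom_def)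

lemma homogeneous_carrier: "homogeneous B n c \<Longrightarrow> set_mset (image_mset snd c) \<subseteq> carrier (grp K n)"
  using grp.basis_carrier[of n] by (fastforce simp: homogeneous_def is_chain_def gens_def)

lemma elem_of_closed [simp]: "homogeneous B n c \<Longrightarrow> elem_of K n c \<in> carrier (grp K n)"
  unfolding elem_of_def by (rule grp.nat_comb_closed) (rule homogeneous_carrier)

lemma elem_of_add:
  "homogeneous B n c \<Longrightarrow> homogeneous B n c' \<Longrightarrow>
    elem_of K n (c + c') = elem_of K n c \<otimes>\<^bsub>grp K n\<^esub> elem_of K n c'"
  unfolding elem_of_def using homogeneous_carrier[of n c] homogeneous_carrier[of n c']
  by (simp add: grp.nat_comb_add)

lemma elem_of_empty: "elem_of K n {#} = \<one>\<^bsub>grp K n\<^esub>"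
  by (simp add: elem_of_def grp.nat_comb_empty)

text \<open>Integer coefficients are kept because they are additive, which the signed parts are
  not.\<close>

definition bdry_coeff :: "nat \<Rightarrow> 'a chain \<Rightarrow> 'a \<Rightarrow> int" where
  "bdry_coeff n c x =
     Poly_Mapping.lookup (coords (grp K n) (B n) (bdry K n (elem_of K (Suc n) c))) x"

lemma bdry_coeff_add:
  assumes "homogeneous B (Suc n) c" "homogeneous B (Suc n) c'"
  shows "bdry_coeff n (c + c') x = bdry_coeff n c x + bdry_coeff n c' x"
  using assms hom_mult[OF bdry_hom, of "elem_of K (Suc n) c" n "elem_of K (Suc n) c'"]
  by (simp add: bdry_coeff_def elem_of_add grp.coords_mult lookup_add)

lemma bdry_one: "bdry K n \<one>\<^bsub>grp K (Suc n)\<^esub> = \<one>\<^bsub>grp K n\<^esub>"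
  by (rule hom_one[OF bdry_hom]) (rule grp.is_group)+

lemma bdry_coeff_empty [simp]: "bdry_coeff n {#} x = 0"
  by (simp add: bdry_coeff_def elem_of_empty bdry_one grp.coords_one)

lemma count_signed_bdry:
  "count (signed_bdry K B \<alpha> n c) (k, x) = (if k = n then nat (signed \<alpha> (bdry_coeff n c x)) else 0)"
proof -
  have "count (image_mset (Pair n) M) (k, x) = (if k = n then count M x else 0)" for M :: "'a multiset"
    by (induction M) auto
  then show ?thesis
    by (simp add: signed_bdry_def bdry_coeff_def count_signed_part)
qed

lemma signed_bdry_cong:
  "(\<And>x. bdry_coeff n c x = bdry_coeff n c' x) \<Longrightarrow> signed_bdry K B \<alpha> n c = signed_bdry K B \<alpha> n c'"
  by (rule chain_eqI) (simp add: count_signed_bdry)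

lemma signed_bdry_empty [simp]: "signed_bdry K B \<alpha> n {#} = {#}"
  by (rule chain_eqI) (cases \<alpha>; simp add: count_signed_bdry)

lemma homogeneous_signed_bdry:
  assumes "homogeneous B (Suc n) c"
  shows "homogeneous B n (signed_bdry K B \<alpha> n c)"
  using grp.set_signed_part[of "bdry K n (elem_of K (Suc n) c)" n \<alpha>]
    grp.coords_spec(1)[of "bdry K n (elem_of K (Suc n) c)" n] assms
  by (auto simp: homogeneous_def[of B n] is_chain_def gens_def signed_bdry_def)

lemma elem_of_signed_bdry:
  assumes "homogeneous B (Suc n) c"
  shows "elem_of K n (signed_bdry K B Plus n c) =
    elem_of K n (signed_bdry K B Minus n c) \<otimes>\<^bsub>grp K n\<^esub> bdry K n (elem_of K (Suc n) c)"
  using grp.nat_comb_signed_parts[OF bdry_closed[OF elem_of_closed[OF assms]]]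
  by (simp add: elem_of_def signed_bdry_def multiset.map_comp comp_def)

text \<open>The two signed boundaries of \<open>c\<close> differ by the boundary of
  \<open>c\<close>, and a boundary of a boundary vanishes.\<close>

lemma bdry_coeff_signed_bdry:
  assumes c: "homogeneous B (Suc (Suc n)) c"
  shows "bdry_coeff n (signed_bdry K B Plus (Suc n) c) x =
    bdry_coeff n (signed_bdry K B Minus (Suc n) c) x"
  using elem_of_signed_bdry[OF c] homogeneous_signed_bdry[OF c] c
    hom_mult[OF bdry_hom, of "elem_of K (Suc n) (signed_bdry K B Minus (Suc n) c)" n
      "bdry K (Suc n) (elem_of K (Suc (Suc n)) c)"]
  by (simp add: bdry_coeff_def bdry_bdry)

section \<open>Augmentation of chains of degree zero\<close>

definition chain_aug :: "'a chain \<Rightarrow> int" where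
  "chain_aug c = aug K (elem_of K 0 c)"

lemma chain_aug_empty [simp]: "chain_aug {#} = 0"
  using hom_one[OF aug_hom grp.is_group group_integer_group]
  by (simp add: chain_aug_def elem_of_empty)

lemma chain_aug_add:
  "homogeneous B 0 c \<Longrightarrow> homogeneous B 0 c' \<Longrightarrow> chain_aug (c + c') = chain_aug c + chain_aug c'"
  using hom_mult[OF aug_hom, of "elem_of K 0 c" "elem_of K 0 c'"]
  by (simp add: chain_aug_def elem_of_add)

lemma chain_aug_signed_bdry:
  assumes "homogeneous B (Suc 0) c"
  shows "chain_aug (signed_bdry K B Plus 0 c) = chain_aug (signed_bdry K B Minus 0 c)"
  using elem_of_signed_bdry[OF assms] homogeneous_signed_bdry[OF assms] assms
    hom_mult[OF aug_hom, of "elem_of K 0 (signed_bdry K B Minus 0 c)"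
      "bdry K 0 (elem_of K (Suc 0) c)"]
  by (simp add: chain_aug_def aug_bdry)

section \<open>Descending recursion for faces and their coefficients\<close>

lemma chain_face_id: "deg a \<le> int n \<Longrightarrow> chain_face K B \<alpha> n a = a"
  by (subst chain_face.simps) simp

definition face_part :: "sign \<Rightarrow> nat \<Rightarrow> 'a chain \<Rightarrow> 'a chain" where
  "face_part \<alpha> n a = homog_part n (chain_face K B \<alpha> n a)"

text \<open>The recursive clause survives when \<open>deg a \<le> int n\<close>: the part of degree
  \<open>n + 1\<close> is then empty and the low part is all of \<open>a\<close>. Later proofs thus
  need no case split on the degree.\<close>

lemma chain_face_rec:
  "chain_face K B \<alpha> n a =
    signed_bdry K B \<alpha> n (face_part \<alpha> (Suc n) a) + low_part (int n) (chain_face K B \<alpha> (Suc n) a)"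
proof (cases "deg a \<le> int n")
  case True
  then show ?thesis
    using deg_le_Suc[OF True]
    by (simp add: chain_face_id face_part_def homog_part_above_deg low_part_deg)
next
  case False
  then show ?thesis
    by (subst chain_face.simps) (simp add: face_part_def)
qed

text \<open>Faces are computed from the top down, so the induction starts at all \<open>n\<close>
  not below the degree and descends.\<close>

lemma chain_face_induct [case_names high step]:
  fixes a :: "'a chain"
  assumes "\<And>n. deg a \<le> int n \<Longrightarrow> P n" "\<And>n. P (Suc n) \<Longrightarrow> P n"
  shows "P n"
proof (induction "nat (deg a - int n)" arbitrary: n)
  case 0
  then show ?case
    by (intro assms(1)) simp
next
  case (Suc k)
  from Suc(2) have "k = nat (deg a - int (Suc n))"
    by simp
  then show ?case
    by (rule assms(2)[OF Suc(1)])
qed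

lemma is_chain_chain_face: "is_chain B a \<Longrightarrow> is_chain B (chain_face K B \<alpha> n a)"
proof (induction n rule: chain_face_induct[of a])
  case (step n)
  then have "homogeneous B (Suc n) (face_part \<alpha> (Suc n) a)"
    by (simp add: face_part_def homogeneous_homog_part)
  from homogeneous_signed_bdry[OF this, of \<alpha>] step show ?case
    by (subst chain_face_rec) (auto simp: homogeneous_def is_chain_low_part)
qed (simp add: chain_face_id)

lemma homogeneous_face_part: "is_chain B a \<Longrightarrow> homogeneous B n (face_part \<alpha> n a)"
  by (simp add: face_part_def homogeneous_homog_part is_chain_chain_face)

lemma count_chain_face_low_high:
  "(j < n \<longrightarrow> count (chain_face K B \<alpha> n a) (j, x) = count a (j, x)) \<and>
   (n < j \<longrightarrow> count (chain_face K B \<alpha> n a) (j, x) = 0)"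
proof (induction n rule: chain_face_induct[of a])
  case (high n)
  then have "n < j \<longrightarrow> (j, x) \<notin># a"
    by (auto simp: deg_le_iff)
  with high show ?case
    by (simp add: chain_face_id not_in_iff)
next
  case (step n)
  then show ?case
    by (subst (1 2) chain_face_rec) (auto simp: count_signed_bdry count_low_part)
qed

lemma deg_chain_face: "deg (chain_face K B \<alpha> n a) \<le> int n"
  unfolding deg_le_iff
  by (metis count_chain_face_low_high count_eq_zero_iff linorder_not_less prod.collapse)

lemma face_part_rec:
  "face_part \<alpha> n a = signed_bdry K B \<alpha> n (face_part \<alpha> (Suc n) a) + homog_part n a"
  by (rule chain_eqI)
    (auto simp: face_part_def[of _ n] count_homog_part chain_face_rec[of _ n]
      count_chain_face_low_high count_low_part count_signed_bdry)

text \<open>Globularity. One degree down, the parts for the two signs are the two signed boundaries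
  of a single chain plus a common summand, and such signed boundaries have the same
  boundary.\<close>

lemma bdry_coeff_face_part:
  assumes "is_chain B a"
  shows "bdry_coeff n (face_part Plus (Suc n) a) x = bdry_coeff n (face_part Minus (Suc n) a) x"
proof (induction n arbitrary: x rule: chain_face_induct[of a])
  case (high n)
  then have "deg a \<le> int (Suc n)"
    by simp
  then show ?case
    by (simp add: face_part_def chain_face_id)
next
  case (step n)
  have "signed_bdry K B Plus (Suc n) (face_part Plus (Suc (Suc n)) a) =
      signed_bdry K B Plus (Suc n) (face_part Minus (Suc (Suc n)) a)"
    by (rule signed_bdry_cong) (rule step)
  then show ?case
    using homogeneous_face_part[OF assms]
    by (simp add: face_part_rec[of _ "Suc n"] bdry_coeff_add bdry_coeff_signed_bdry
        homogeneous_signed_bdry homogeneous_homog_part assms)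
qed

text \<open>For a chain \<open>a\<close> the sign \<open>Minus\<close> would give the same vector,
  by globularity; this one vector therefore determines both faces in degree
  \<open>n\<close>.\<close>

definition face_coeff :: "nat \<Rightarrow> 'a chain \<Rightarrow> 'a \<Rightarrow> int" where
  "face_coeff n a x = bdry_coeff n (face_part Plus (Suc n) a) x"

lemma face_coeff_eq: "is_chain B a \<Longrightarrow> bdry_coeff n (face_part \<alpha> (Suc n) a) x = face_coeff n a x"
  by (cases \<alpha>) (simp_all add: face_coeff_def bdry_coeff_face_part)

lemma count_chain_face:
  assumes "is_chain B a"
  shows "count (chain_face K B \<alpha> n a) (j, x) =
    (if j < n then count a (j, x)
     else if j = n then nat (signed \<alpha> (face_coeff n a x)) + count a (n, x) else 0)"
proof (cases "j = n")
  case True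
  have "count (chain_face K B \<alpha> n a) (n, x) = count (face_part \<alpha> n a) (n, x)"
    by (simp add: face_part_def count_homog_part)
  then show ?thesis
    using True assms by (simp add: face_part_rec[of _ n] count_signed_bdry count_homog_part face_coeff_eq)
qed (use count_chain_face_low_high in auto)

lemma chain_aug_chain_face:
  assumes "is_chain B a"
  shows "chain_aug (chain_face K B Plus 0 a) = chain_aug (chain_face K B Minus 0 a)"
proof -
  \<comment> \<open>The inner sign is \<open>Plus\<close> whatever \<alpha> is: a signed boundary
    depends only on the boundary, which both signs share. So the two faces come from one
    chain.\<close>
  have eq: "chain_face K B \<alpha> 0 a = signed_bdry K B \<alpha> 0 (face_part Plus (Suc 0) a) + homog_part 0 a"
    for \<alpha>
    using assms by (intro chain_eqI)
      (simp add: count_chain_face count_signed_bdry count_homog_part face_coeff_eq)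
  show ?thesis
    using assms homogeneous_face_part[OF assms]
    by (simp add: eq chain_aug_add chain_aug_signed_bdry homogeneous_signed_bdry
        homogeneous_homog_part)
qed

text \<open>The recursion reduces everything to \<open>j = n - 1\<close>. There the face vector of
  \<open>chain_face K B \<beta> n a\<close>, a chain of degree at most \<open>n\<close>, is the
  boundary of its own degree \<open>n\<close> part, which is the face vector of
  \<open>a\<close>.\<close>

lemma chain_face_chain_face:
  assumes a: "is_chain B a" and "j < n"
  shows "chain_face K B \<alpha> j (chain_face K B \<beta> n a) = chain_face K B \<alpha> j a"
proof -
  from \<open>j < n\<close> obtain k where n: "n = Suc k" and "j \<le> k"
    by (cases n) auto
  let ?a' = "chain_face K B \<beta> n a"
  show ?thesis
    using \<open>j \<le> k\<close>
  proof (induction j rule: inc_induct)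
    case base
    have "face_coeff k ?a' x = face_coeff k a x" for x
      using face_coeff_eq[OF a, of k \<beta> x] deg_chain_face[of \<beta> n a]
      by (simp add: face_coeff_def face_part_def chain_face_id n)
    then show ?case
      using a
      by (intro chain_eqI) (auto simp: count_chain_face is_chain_chain_face n)
  next
    case (step j)
    then show ?case
      by (simp add: chain_face_rec[of _ j] face_part_def)
  qed
qed

section \<open>Coherence as a single equation\<close>

definition end_aug :: "'a chain \<Rightarrow> int" where
  "end_aug a = chain_aug (chain_face K B Plus 0 a)"

lemma coherent_iff: "coherent K B a \<longleftrightarrow> is_chain B a \<and> end_aug a = 1"
  using chain_aug_chain_face[of a]
  by (auto simp: coherent_def end_aug_def chain_aug_def) (metis sign.exhaust)

text \<open>This transports coherence: chains that share a face, in any degree and with any signs,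
  have the same augmentation. Degree 0 is separate because the globular identity needs a strict
  inequality.\<close>

lemma end_aug_chain_face:
  assumes "is_chain B a"
  shows "end_aug (chain_face K B \<alpha> n a) = end_aug a"
proof (cases "n = 0")
  case True
  then show ?thesis
    using assms chain_aug_chain_face[of a] deg_chain_face[of \<alpha> 0 a]
    by (cases \<alpha>) (auto simp: end_aug_def chain_face_id)
next
  case False
  then show ?thesis
    using assms by (simp add: end_aug_def chain_face_chain_face)
qed

section \<open>Additivity of face vectors\<close>

lemma chain_face_add_low:
  assumes "deg c \<le> int n"
  shows "chain_face K B \<alpha> n (a + c) = chain_face K B \<alpha> n a + c"
  using assms
proof (induction n rule: chain_face_induct[of "a + c"])
  case (high n)
  then have "deg a \<le> int n"
    by (auto simp: deg_le_iff)
  then show ?case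
    using high by (simp add: chain_face_id)
next
  case (step n)
  then show ?case
    using step deg_le_Suc[of c n]
    by (simp add: chain_face_rec[of _ n] face_part_def homog_part_add low_part_add
        homog_part_above_deg low_part_deg)
qed

text \<open>Faces are not additive in general, since opposite coefficients cancel. A summand of
  degree at most \<open>n + 1\<close> is merely added to the face in degree \<open>n + 1\<close>,
  and the boundary is a homomorphism.\<close>

lemma face_coeff_add_low:
  assumes "is_chain B a" "is_chain B c" "deg c \<le> int (Suc n)"
  shows "face_coeff n (a + c) x = face_coeff n a x + face_coeff n c x"
proof -
  have "face_part Plus (Suc n) (a + c) = face_part Plus (Suc n) a + face_part Plus (Suc n) c"
    using assms by (simp add: face_part_def chain_face_add_low chain_face_id homog_part_add)
  then show ?thesis
    using assms by (simp add: face_coeff_def bdry_coeff_add homogeneous_face_part)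
qed

lemma face_coeff_low:
  assumes "deg c \<le> int n"
  shows "face_coeff n c x = 0"
  using assms deg_le_Suc[OF assms]
  by (simp add: face_coeff_def face_part_def chain_face_id homog_part_above_deg)

lemma face_coeff_sum:
  assumes "finite I" "\<And>i. i \<in> I \<Longrightarrow> b i \<in> gens B"
    and "\<And>i j. \<lbrakk>i \<in> I; j \<in> I; i \<noteq> j\<rbrakk> \<Longrightarrow> fst (b i) \<le> Suc n \<or> fst (b j) \<le> Suc n"
  shows "face_coeff n (\<Sum>i\<in>I. {#b i#}) x = (\<Sum>i\<in>I. face_coeff n {#b i#} x)"
  using assms
proof (induction I rule: finite_induct)
  case empty
  show ?case
    by (simp add: face_coeff_low deg_def)
next
  case (insert i I)
  let ?s = "\<Sum>i\<in>I. {#b i#}"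
  have s: "is_chain B ?s"
    using insert.prems by (intro is_chain_sum) simp
  have "face_coeff n ({#b i#} + ?s) x = face_coeff n {#b i#} x + face_coeff n ?s x"
  proof (cases "fst (b i) \<le> Suc n")
    case True
    then show ?thesis
      using face_coeff_add_low[of ?s "{#b i#}" n x] s insert.prems
      by (simp add: deg_le_iff del: of_nat_Suc)
  next
    case False
    \<comment> \<open>If the new generator is the high one, all others are low, and the summands
      exchange roles.\<close>
    have "fst (b j) \<le> Suc n" if "j \<in> I" for j
      using that False insert.prems(2)[of i j] insert.hyps(2) by auto
    then have "deg ?s \<le> int (Suc n)"
      using insert.hyps by (auto simp: deg_le_iff set_mset_sum simp del: of_nat_Suc)
    then show ?thesis
      using face_coeff_add_low[of "{#b i#}" ?s n x] s insert.prems by simp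
  qed
  moreover have "face_coeff n ?s x = (\<Sum>i\<in>I. face_coeff n {#b i#} x)"
    by (rule insert.IH) (use insert.prems in auto)
  ultimately show ?case
    using insert.hyps by simp
qed

lemma gen_face_eq_chain_face: "n \<le> fst b \<Longrightarrow> gen_face K B \<alpha> n b = chain_face K B \<alpha> n {#b#}"
proof (induction n rule: inc_induct)
  case base
  then show ?case
    by (simp add: atom_face.simps chain_face_id deg_le_iff)
next
  case (step n)
  let ?c = "chain_face K B \<alpha> (Suc n) {#b#}"
  \<comment> \<open>As \<open>n < fst b\<close>, the face of the generator lies in degree
    \<open>n + 1\<close> alone, so the low part in the recursion drops out.\<close>
  have "count ?c (j, x) = 0" if "j \<noteq> Suc n" for j x
    using that step count_chain_face_low_high[of j "Suc n" \<alpha> "{#b#}" x] by auto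
  then have "homog_part (Suc n) ?c = ?c" "low_part (int n) ?c = {#}"
    by (auto intro!: chain_eqI simp: count_homog_part count_low_part simp del: count_eq_zero_iff)
  then show ?case
    using step by (simp add: atom_face.simps[of _ _ _ _ n] chain_face_rec[of _ n] face_part_def)
qed

end

section \<open>Slicing a chain along a linear order\<close>

text \<open>At a fixed basis element, \<open>d\<close>, \<open>r\<close>, \<open>e\<close> stand for
  the total flow before, at and after the generator \<open>b k\<close>. The left side is the
  coefficient in \<open>d_n^+\<close> of the slice, the right side the level, both without the share
  of \<open>a\<close>.\<close>

lemma max_truncated_eq:
  fixes d e r :: int
  assumes "(d \<le> 0 \<and> r \<le> 0) \<or> (0 \<le> e \<and> 0 \<le> r)"
  shows "int (nat r + max (nat (- d) - nat r) (nat e - nat (- r))) = int (nat (d + r + e)) - d"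
  using assms unfolding of_nat_add of_nat_max
  by (elim disjE conjE; simp split: nat_diff_split)

lemma count_sum_gens:
  fixes b :: "'i \<Rightarrow> nat \<times> 'a"
  assumes "\<And>i. i \<in> I \<Longrightarrow> n < fst (b i)" "j \<le> n"
  shows "count (\<Sum>i\<in>I. {#b i#}) (j, x) = 0"
proof -
  have "count {#b i#} (j, x) = 0" if "i \<in> I" for i
    using assms(1)[OF that] assms(2) by auto
  then show ?thesis
    by (simp add: count_sum del: count_single count_add_mset)
qed

text \<open>The ordering is imposed at one basis element at a time and \<open>b\<close> may repeat
  values. This covers both the ordered form of the theorem and the listing with repetitions used to
  bound multiplicities.\<close>

locale ordered_slices = based_adc K B
  for K :: "'a adc" and B :: "nat \<Rightarrow> 'a set" +
  fixes a :: "'a chain" and n m :: nat and b :: "nat \<Rightarrow> nat \<times> 'a"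
  assumes chain: "is_chain B a"
    and decomp: "a = (\<Sum>i\<le>m. {#b i#}) + low_part (int n) a"
    and above: "i \<le> m \<Longrightarrow> n < fst (b i)"
    and top: "\<lbrakk>i \<le> m; j \<le> m; i \<noteq> j\<rbrakk> \<Longrightarrow> fst (b i) \<le> Suc n \<or> fst (b j) \<le> Suc n"
    and ordered: "\<lbrakk>i < j; j \<le> m; face_coeff n {#b j#} x < 0\<rbrakk> \<Longrightarrow> face_coeff n {#b i#} x \<le> 0"
begin

definition slice :: "nat \<Rightarrow> 'a chain" where
  "slice k = {#b k#}
     + ((chain_face K B Minus n (\<Sum>i<k. {#b i#}) - chain_face K B Plus n {#b k#})
        \<union># (chain_face K B Plus n (\<Sum>i\<in>{k<..m}. {#b i#}) - chain_face K B Minus n {#b k#}))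
     + low_part (int n) a"

definition flow :: "nat \<Rightarrow> 'a \<Rightarrow> int" where
  "flow i x = face_coeff n {#b i#} x"

text \<open>\<open>level 0\<close> gives the coefficients of \<open>d_n^+ a\<close> in degree
  \<open>n\<close> and \<open>level (Suc m)\<close> those of \<open>d_n^- a\<close>; the levels
  between are the common faces of consecutive slices.\<close>

definition level :: "nat \<Rightarrow> 'a \<Rightarrow> int" where
  "level k x = int (nat (\<Sum>i\<le>m. flow i x)) - (\<Sum>i<k. flow i x) + int (count a (n, x))"

lemma level_Suc: "level (Suc k) x = level k x - flow k x"
  by (simp add: level_def)

lemma gens_b: "i \<le> m \<Longrightarrow> b i \<in> gens B"
  using chain by (subst (asm) decomp) (auto simp: is_chain_def set_mset_sum)

lemma is_chain_sum_b: "I \<subseteq> {..m} \<Longrightarrow> is_chain B (\<Sum>i\<in>I. {#b i#})"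
  using gens_b by (intro is_chain_sum) auto

lemma count_sum_b: "I \<subseteq> {..m} \<Longrightarrow> j \<le> n \<Longrightarrow> count (\<Sum>i\<in>I. {#b i#}) (j, x) = 0"
  using above by (intro count_sum_gens[of I n]) auto

lemma face_coeff_sum_b: "I \<subseteq> {..m} \<Longrightarrow> face_coeff n (\<Sum>i\<in>I. {#b i#}) x = (\<Sum>i\<in>I. flow i x)"
  unfolding flow_def using gens_b top
  by (intro face_coeff_sum) (auto simp: subset_iff intro: finite_subset[of I "{..m}"])

lemma face_coeff_sum_b_add:
  assumes "I \<subseteq> {..m}" "is_chain B c" "deg c \<le> int n"
  shows "face_coeff n ((\<Sum>i\<in>I. {#b i#}) + c) x = (\<Sum>i\<in>I. flow i x)"
  using assms deg_le_Suc[of c n]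
  by (simp add: face_coeff_add_low is_chain_sum_b face_coeff_low face_coeff_sum_b)

lemma deg_low_part: "deg (low_part (int n) a) \<le> int n"
  by (auto simp: deg_le_iff low_part_def)

lemma face_coeff_a: "face_coeff n a x = (\<Sum>i\<le>m. flow i x)"
  by (subst decomp) (simp add: face_coeff_sum_b_add chain is_chain_low_part deg_low_part)

lemma count_faces_b:
  assumes "I \<subseteq> {..m}"
  shows "count (chain_face K B \<alpha> n (\<Sum>i\<in>I. {#b i#})) (j, x) =
    (if j = n then nat (signed \<alpha> (\<Sum>i\<in>I. flow i x)) else 0)"
  using assms
  by (simp add: count_chain_face is_chain_sum_b count_sum_b face_coeff_sum_b)

lemma count_face_b:
  assumes "k \<le> m"
  shows "count (chain_face K B \<alpha> n {#b k#}) (j, x) =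
    (if j = n then nat (signed \<alpha> (flow k x)) else 0)"
  using assms count_faces_b[of "{k}"] by simp

lemma count_slice:
  assumes "k \<le> m"
  shows "count (slice k) (j, x) =
    (if j < n then count a (j, x)
     else if j = n then max (nat (- (\<Sum>i<k. flow i x)) - nat (flow k x))
       (nat (\<Sum>i\<in>{k<..m}. flow i x) - nat (- flow k x)) + count a (n, x)
     else count {#b k#} (j, x))"
proof -
  have "{..<k} \<subseteq> {..m}" "{k<..m} \<subseteq> {..m}" "j \<le> n \<Longrightarrow> b k \<noteq> (j, x)"
    using assms above[OF assms] by auto
  then show ?thesis
    using assms by (cases j n rule: linorder_cases)
      (simp_all add: slice_def count_faces_b count_face_b count_low_part)
qed

lemma is_chain_slice: "k \<le> m \<Longrightarrow> is_chain B (slice k)"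
  unfolding slice_def using gens_b
  by (auto intro!: is_chain_union is_chain_low_part chain is_chain_subset[OF _ diff_subset_eq_self]
      is_chain_chain_face is_chain_sum_b)

text \<open>Everything in the slice except \<open>b k\<close> has degree at most \<open>n\<close>
  and so contributes no flow.\<close>

lemma face_coeff_slice:
  assumes "k \<le> m"
  shows "face_coeff n (slice k) x = flow k x"
proof -
  define c where "c = (chain_face K B Minus n (\<Sum>i<k. {#b i#}) - chain_face K B Plus n {#b k#})
        \<union># (chain_face K B Plus n (\<Sum>i\<in>{k<..m}. {#b i#}) - chain_face K B Minus n {#b k#})
     + low_part (int n) a"
  have s: "slice k = (\<Sum>i\<in>{k}. {#b i#}) + c"
    by (simp add: slice_def c_def)
  have "is_chain B c"
    using is_chain_slice[OF assms] s by simp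
  moreover have "deg c \<le> int n"
    using deg_chain_face[of Minus n "\<Sum>i<k. {#b i#}"]
      deg_chain_face[of Plus n "\<Sum>i\<in>{k<..m}. {#b i#}"] deg_low_part
    by (auto simp: deg_le_iff c_def dest!: in_diffD)
  ultimately show ?thesis
    unfolding s using assms by (subst face_coeff_sum_b_add) auto
qed

text \<open>Along the ordering the flows at \<open>x\<close> pass from nonpositive to nonnegative. A
  positive flow up to \<open>k\<close> excludes negative ones after it; without one, all flows up to
  \<open>k\<close> are nonpositive.\<close>

lemma flow_before_or_after:
  assumes "k \<le> m"
  shows "((\<Sum>i<k. flow i x) \<le> 0 \<and> flow k x \<le> 0) \<or> (0 \<le> (\<Sum>i\<in>{k<..m}. flow i x) \<and> 0 \<le> flow k x)"
proof (cases "\<exists>i\<le>k. 0 < flow i x")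
  case True
  then obtain i where i: "i \<le> k" "0 < flow i x"
    by blast
  have nonneg: "0 \<le> flow j x" if "i \<le> j" "j \<le> m" for j
  proof (rule ccontr)
    assume neg: "\<not> 0 \<le> flow j x"
    then have "i < j"
      using that i by (cases "i = j") auto
    with neg that ordered[of i j x] i show False
      by (simp add: flow_def)
  qed
  have "0 \<le> (\<Sum>i\<in>{k<..m}. flow i x)"
    by (rule sum_nonneg) (use nonneg i in auto)
  then show ?thesis
    using nonneg i assms by auto
next
  case False
  then have "(\<Sum>i<k. flow i x) \<le> 0"
    by (intro sum_nonpos) (auto simp: not_less)
  then show ?thesis
    using False by (auto simp: not_less)
qed

lemma count_slice_level:
  assumes "k \<le> m"
  shows "int (nat (flow k x) + count (slice k) (n, x)) = level k x"
proof -
  have "{..m} = {..<Suc k} \<union> {k<..m}"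
    using assms by auto
  then have "(\<Sum>i\<le>m. flow i x) = (\<Sum>i<k. flow i x) + flow k x + (\<Sum>i\<in>{k<..m}. flow i x)"
    by (simp only:) (subst sum.union_disjoint; auto)
  then show ?thesis
    using max_truncated_eq[OF flow_before_or_after[OF assms, of x]] assms
    by (simp add: count_slice level_def)
qed

text \<open>The two faces of a slice differ by its flow, since \<open>nat r\<close> and
  \<open>nat (- r)\<close> differ by \<open>r\<close>.\<close>

lemma count_slice_level_Suc:
  assumes "k \<le> m"
  shows "int (nat (- flow k x) + count (slice k) (n, x)) = level (Suc k) x"
  using count_slice_level[OF assms, of x] unfolding level_Suc by linarith

lemma count_chain_face_slice:
  assumes "k \<le> m"
  shows "int (count (chain_face K B Plus n (slice k)) (n, x)) = level k x"
    and "int (count (chain_face K B Minus n (slice k)) (n, x)) = level (Suc k) x"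
  using count_slice_level[OF assms, of x] count_slice_level_Suc[OF assms, of x] assms
  by (simp_all add: count_chain_face is_chain_slice face_coeff_slice)

lemma count_chain_face_a: "int (count (chain_face K B Plus n a) (n, x)) = level 0 x"
  by (simp add: count_chain_face chain face_coeff_a level_def)

lemma slices_composable:
  assumes "k < m"
  shows "chain_face K B Minus n (slice k) = chain_face K B Plus n (slice (Suc k))"
proof (rule chain_eqI)
  fix j x
  have "k \<le> m" "Suc k \<le> m"
    using assms by auto
  moreover from this have "count (chain_face K B Minus n (slice k)) (n, x) =
      count (chain_face K B Plus n (slice (Suc k))) (n, x)"
    by (metis count_chain_face_slice of_nat_eq_iff)
  ultimately show "count (chain_face K B Minus n (slice k)) (j, x) =
      count (chain_face K B Plus n (slice (Suc k))) (j, x)"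
    by (cases j n rule: linorder_cases) (simp_all add: count_chain_face_low_high count_slice)
qed

lemma chain_face_slice_0: "chain_face K B Plus n (slice 0) = chain_face K B Plus n a"
proof (rule chain_eqI)
  fix j x
  have "count (chain_face K B Plus n (slice 0)) (n, x) = count (chain_face K B Plus n a) (n, x)"
    by (metis count_chain_face_slice(1) count_chain_face_a of_nat_eq_iff le0)
  then show "count (chain_face K B Plus n (slice 0)) (j, x) = count (chain_face K B Plus n a) (j, x)"
    by (cases j n rule: linorder_cases) (simp_all add: count_chain_face_low_high count_slice)
qed

text \<open>The first slice shares \<open>d_n^+\<close> with \<open>a\<close>, and each later slice
  shares a face with its predecessor.\<close>

lemma end_aug_slice: "k \<le> m \<Longrightarrow> end_aug (slice k) = end_aug a"
proof (induction k)
  case 0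
  show ?case
    by (metis chain chain_face_slice_0 end_aug_chain_face is_chain_slice le0)
next
  case (Suc k)
  then have "k < m"
    by simp
  then show ?case
    using Suc by (metis end_aug_chain_face is_chain_slice slices_composable less_imp_le)
qed

lemma coherent_slice: "coherent K B a \<Longrightarrow> k \<le> m \<Longrightarrow> coherent K B (slice k)"
  by (simp add: coherent_iff is_chain_slice end_aug_slice)

lemma coherent_chain_face: "coherent K B c \<Longrightarrow> coherent K B (chain_face K B \<alpha> i c)"
  by (simp add: coherent_iff is_chain_chain_face end_aug_chain_face)

text \<open>The degree \<open>n\<close> part is forced by the intended faces. They are the levels
  \<open>0\<close> and \<open>Suc k\<close>, whose difference is the total flow of
  \<open>b 0, ..., b k\<close>; removing its positive part from \<open>level 0\<close> leaves the
  minimum of the two.\<close>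

definition partial_composite :: "nat \<Rightarrow> 'a chain" where
  "partial_composite k =
     (\<Sum>i\<le>k. {#b i#}) + (chain_face K B Plus n a \<inter># chain_face K B Minus n (slice k))"

lemma count_partial_composite:
  assumes "k \<le> m"
  shows "j < n \<Longrightarrow> count (partial_composite k) (j, x) = count a (j, x)"
    and "int (count (partial_composite k) (n, x)) = min (level 0 x) (level (Suc k) x)"
    and "n < j \<Longrightarrow> count (partial_composite k) (j, x) = count (\<Sum>i\<le>k. {#b i#}) (j, x)"
proof -
  have "{..k} \<subseteq> {..m}"
    using assms by auto
  then show "j < n \<Longrightarrow> count (partial_composite k) (j, x) = count a (j, x)"
    and "int (count (partial_composite k) (n, x)) = min (level 0 x) (level (Suc k) x)"
    and "n < j \<Longrightarrow> count (partial_composite k) (j, x) = count (\<Sum>i\<le>k. {#b i#}) (j, x)"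
    using assms
    by (simp_all add: partial_composite_def count_sum_b count_chain_face_low_high count_slice
        count_chain_face_a count_chain_face_slice of_nat_min)
qed

lemma is_chain_partial_composite: "k \<le> m \<Longrightarrow> is_chain B (partial_composite k)"
  using is_chain_subset[OF is_chain_chain_face[OF chain], of _ Plus n] is_chain_sum_b[of "{..k}"]
  by (auto simp: partial_composite_def)

lemma chain_face_partial_composite:
  assumes "k \<le> m"
  shows "chain_face K B Minus n (partial_composite k) = chain_face K B Minus n (slice k)"
proof (rule chain_eqI)
  fix j x
  have "deg (chain_face K B Plus n a \<inter># chain_face K B Minus n (slice k)) \<le> int n"
    using deg_chain_face[of Plus n a] by (auto simp: deg_le_iff)
  then have "face_coeff n (partial_composite k) x = (\<Sum>i\<le>k. flow i x)"
    unfolding partial_composite_def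
    using assms is_chain_subset[OF is_chain_chain_face[OF chain], of _ Plus n]
    by (intro face_coeff_sum_b_add) auto
  also have "\<dots> = level 0 x - level (Suc k) x"
    by (simp add: level_def lessThan_Suc_atMost)
  finally have "int (count (chain_face K B Minus n (partial_composite k)) (n, x)) = level (Suc k) x"
    using count_partial_composite(2)[OF assms, of x] is_chain_partial_composite[OF assms]
    by (simp add: count_chain_face)
  then have "count (chain_face K B Minus n (partial_composite k)) (n, x) =
      count (chain_face K B Minus n (slice k)) (n, x)"
    using count_chain_face_slice(2)[OF assms, of x] by simp
  then show "count (chain_face K B Minus n (partial_composite k)) (j, x) =
      count (chain_face K B Minus n (slice k)) (j, x)"
    using assms count_partial_composite(1)[of k j x]
    by (cases j n rule: linorder_cases) (simp_all add: count_chain_face_low_high count_slice)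
qed

lemma partial_composite_0: "partial_composite 0 = slice 0"
proof (rule chain_eqI)
  fix j x
  \<comment> \<open>One of \<open>nat r\<close> and \<open>nat (- r)\<close> is zero, so the
    coefficient in a slice is the minimum of its two levels.\<close>
  have "int (count (partial_composite 0) (n, x)) = int (count (slice 0) (n, x))"
    using count_partial_composite(2)[of 0 x] count_slice_level[of 0 x]
      count_slice_level_Suc[of 0 x] unfolding level_Suc by linarith
  then show "count (partial_composite 0) (j, x) = count (slice 0) (j, x)"
    using count_partial_composite(1,3)[of 0 j x]
    by (cases j n rule: linorder_cases) (simp_all add: count_slice)
qed

lemma partial_composite_m: "partial_composite m = a"
proof (rule chain_eqI)
  fix j x
  \<comment> \<open>The first and last level exceed \<open>count a (n, x)\<close> by the positive
    and the negative part of the same integer, one of which is zero.\<close>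
  have "int (count (partial_composite m) (n, x)) = int (count a (n, x))"
    using count_partial_composite(2)[of m x]
    by (simp add: level_def lessThan_Suc_atMost min_def)
  moreover have "count a (j, x) = count (\<Sum>i\<le>m. {#b i#}) (j, x)" if "n < j"
    using that by (subst decomp) (simp add: count_low_part)
  ultimately show "count (partial_composite m) (j, x) = count a (j, x)"
    using count_partial_composite(1,3)[of m j x]
    by (cases j n rule: linorder_cases) simp_all
qed

text \<open>For a negative flow of \<open>b (Suc k)\<close> the ordering yields
  \<open>level 0 x \<le> level (Suc k) x\<close>, and both sides equal \<open>level 0 x\<close>. For
  other flows the only delicate case is \<open>level 0 x < level (Suc k) x\<close>: the bound makes
  these 0 and 1, and both sides vanish. Successive levels 1, 2, 1 would break the identity, giving 0
  against 1.\<close>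

lemma partial_composite_Suc:
  assumes "k < m" and thin: "\<And>x. level (Suc k) x \<le> 1"
  shows "partial_composite (Suc k) =
    partial_composite k + slice (Suc k) - chain_face K B Minus n (slice k)"
proof (rule chain_eqI)
  fix j x
  have k: "k \<le> m" "Suc k \<le> m"
    using assms by auto
  have "(\<Sum>i<Suc k. flow i x) \<le> 0" if "flow (Suc k) x < 0"
    using flow_before_or_after[OF k(2), of x] that by linarith
  then have before: "level 0 x \<le> level (Suc k) x" if "flow (Suc k) x < 0"
    using that by (simp add: level_def)
  let ?p = "count (partial_composite k) (n, x)" and ?s = "count (slice (Suc k)) (n, x)"
    and ?f = "count (chain_face K B Minus n (slice k)) (n, x)"
  have p: "int ?p = min (level 0 x) (level (Suc k) x)" and f: "int ?f = level (Suc k) x"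
    and q: "int (count (partial_composite (Suc k)) (n, x)) = min (level 0 x) (level (Suc (Suc k)) x)"
    and s: "int (nat (flow (Suc k) x) + ?s) = level (Suc k) x"
      "int (nat (- flow (Suc k) x) + ?s) = level (Suc (Suc k)) x"
    using k count_partial_composite(2) count_chain_face_slice(2) count_slice_level
      count_slice_level_Suc by auto
  have "int (?p + ?s - ?f) = max 0 (int ?p + int ?s - int ?f)"
    by simp
  also have "\<dots> = min (level 0 x) (level (Suc (Suc k)) x)"
    using p f s before thin[of x] count_chain_face_a[of x]
    by (smt (verit) int_nat_eq of_nat_add of_nat_0_le_iff)
  finally have eq: "count (partial_composite (Suc k)) (n, x) = ?p + ?s - ?f"
    using q by linarith
  show "count (partial_composite (Suc k)) (j, x) =
      count (partial_composite k + slice (Suc k) - chain_face K B Minus n (slice k)) (j, x)"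
  proof (cases j n rule: linorder_cases)
    case less
    then show ?thesis
      using k by (simp add: count_partial_composite count_chain_face_low_high count_slice)
  next
    case equal
    then show ?thesis
      using eq by simp
  next
    case greater
    then show ?thesis
      using k by (simp add: count_partial_composite(3) count_chain_face_low_high count_slice atMost_Suc)
  qed
qed

lemma coherent_in_mu_cells: "coherent K B c \<Longrightarrow> c \<in> (\<Union>i. mu_cells K B i)"
  by (auto simp: mu_cells_def intro!: exI[of _ "nat (deg c)"])

lemma mu_composite_slices:
  assumes a: "coherent K B a" and thin: "\<And>k x. k \<le> m \<Longrightarrow> level (Suc k) x \<le> 1" and "k \<le> m"
  shows "mu_composite K B n slice k = Some (partial_composite k)"
  using \<open>k \<le> m\<close>
proof (induction k)
  case 0
  show ?case
    using coherent_in_mu_cells[OF coherent_slice[OF a]] by (simp add: partial_composite_0)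
next
  case (Suc k)
  then have k: "k < m" "k \<le> m"
    by auto
  \<comment> \<open>\<open>mu_comp\<close> is defined on coherent chains only; coherence is
    inherited through the face \<open>d_n^-\<close> shared with \<open>slice k\<close>.\<close>
  have "coherent K B (partial_composite k)"
    using coherent_slice[OF a k(2)] is_chain_partial_composite[OF k(2)]
    by (metis coherent_iff chain_face_partial_composite[OF k(2)] end_aug_chain_face)
  then show ?case
    using Suc k coherent_in_mu_cells coherent_slice[OF a Suc.prems]
    by (simp add: mu_comp_def chain_face_partial_composite slices_composable[symmetric]
        partial_composite_Suc thin)
qed

end

section \<open>Multiplicities in coherent chains\<close>

text \<open>A minimal element is put first. Equality is exempted because \<open>M\<close> may
  contain several copies of an element and \<open>R\<close> may be reflexive.\<close>

lemma ex_topological_sorting: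
  assumes "antisym R" "trans R"
  shows "\<exists>xs. mset xs = M \<and> sorted_wrt (\<lambda>x y. (y, x) \<in> R \<longrightarrow> x = y) xs"
proof (induction "size M" arbitrary: M)
  case 0
  then show ?case
    by (intro exI[of _ "[]"]) auto
next
  case (Suc k)
  let ?R = "\<lambda>x y. (x, y) \<in> R \<and> x \<noteq> y"
  have "asymp_on (set_mset M) ?R"
    using assms(1) by (auto intro: asymp_onI dest: antisymD)
  moreover have "transp_on (set_mset M) ?R"
    using assms by (auto intro!: transp_onI dest: antisymD transD)
  moreover have "set_mset M \<noteq> {}"
    using Suc by auto
  ultimately obtain y where y: "y \<in># M" "\<And>x. x \<in># M \<Longrightarrow> x \<noteq> y \<Longrightarrow> (x, y) \<notin> R"
    using Finite_Set.bex_min_element[of "set_mset M" ?R] by auto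
  from y(1) have "k = size (M - {#y#})"
    using Suc by (simp add: size_Diff_singleton)
  from Suc(1)[OF this] obtain xs
    where xs: "mset xs = M - {#y#}" "sorted_wrt (\<lambda>x y. (y, x) \<in> R \<longrightarrow> x = y) xs"
    by blast
  then have "x \<in># M" if "x \<in> set xs" for x
    using that by (metis in_diffD set_mset_mset)
  then have "sorted_wrt (\<lambda>x y. (y, x) \<in> R \<longrightarrow> x = y) (y # xs)"
    using xs y(2) by auto
  moreover have "mset (y # xs) = M"
    using xs y by simp
  ultimately show ?case
    by blast
qed

lemma sum_nth_mset: "(\<Sum>i<length xs. {#xs ! i#}) = mset xs"
  by (induction xs rule: rev_induct) (simp_all add: nth_append)

locale unitary_loop_free_adc = based_adc K B
  for K :: "'a adc" and B :: "nat \<Rightarrow> 'a set" +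
  assumes unit: "unitary K B" and loopfree: "loop_free K B"
begin

lemma antisym_odot: "antisym (odot K B n)" and trans_odot: "trans (odot K B n)"
  using loopfree by (auto simp: loop_free_def partial_order_on_def preorder_on_def)

text \<open>The element \<open>x\<close> lies in the source of \<open>y\<close> and in the target of
  \<open>z\<close>, which is one generating step of \<open>odot\<close>.\<close>

lemma odot_if_flow:
  assumes "y \<in> gens B" "z \<in> gens B" "n < fst y" "n < fst z"
    and "face_coeff n {#y#} x < 0" "0 < face_coeff n {#z#} x"
  shows "(y, z) \<in> odot K B n"
proof (rule odot.base)
  have "(n, x) \<in># gen_face K B Minus n y" "(n, x) \<in># gen_face K B Plus n z"
    using assms by (simp_all add: gen_face_eq_chain_face count_chain_face flip: count_greater_zero_iff)
  then have "(n, x) \<in># gen_face K B Minus n y \<inter># gen_face K B Plus n z"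
    by simp
  then show "gen_face K B Minus n y \<inter># gen_face K B Plus n z \<noteq> {#}"
    by (metis empty_not_add_mset multi_member_split)
qed (use assms in auto)

lemma end_aug_single:
  assumes "y \<in> gens B"
  shows "end_aug {#y#} = 1"
  using assms unit
  by (simp add: unitary_def end_aug_def chain_aug_def gen_face_eq_chain_face[of 0])

text \<open>Otherwise \<open>d_n^-\<close> of the generator would be empty and have augmentation 0,
  whereas unitarity makes it 1.\<close>

lemma ex_negative_face_coeff:
  assumes "y \<in> gens B" "n < fst y"
  shows "\<exists>x. face_coeff n {#y#} x < 0"
proof (rule ccontr)
  assume "\<not> ?thesis"
  then have nonneg: "0 \<le> face_coeff n {#y#} x" for x
    by (simp add: not_less)
  have "chain_face K B Minus n {#y#} = {#}"
  proof (rule chain_eqI)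
    fix j x
    show "count (chain_face K B Minus n {#y#}) (j, x) = count {#} (j, x)"
      using assms nonneg[of x] by (auto simp: count_chain_face)
  qed
  then have "end_aug {#y#} = end_aug {#}"
    using assms by (metis end_aug_chain_face is_chain_add_mset is_chain_empty)
  also have "\<dots> = 0"
    by (simp add: end_aug_def chain_face_id deg_def)
  finally show False
    using end_aug_single[OF assms(1)] by simp
qed

text \<open>A generator of degree 0 is its own face, so unitarity gives it augmentation 1. Hence a
  coherent chain of degree 0 is a single generator.\<close>

lemma chain_aug_eq_size: "homogeneous B 0 c \<Longrightarrow> chain_aug c = int (size c)"
proof (induction c)
  case (add y c)
  then have y: "y \<in> gens B" "fst y = 0" and c: "homogeneous B 0 c"
    by (auto simp: homogeneous_def)
  then have "homogeneous B 0 {#y#}"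
    by (auto simp: homogeneous_def)
  moreover have "chain_aug {#y#} = 1"
    using end_aug_single[OF y(1)] y(2) by (simp add: end_aug_def chain_face_id deg_def)
  ultimately show ?case
    using chain_aug_add[of "{#y#}" c] c add.IH by simp
qed simp

text \<open>Passing from one level to the next removes the target of a generator and adds its source.
  If a generator occurred twice in degree \<open>n + 1\<close>, some \<open>x\<close> in its source would be added twice;
  by the ordering \<open>x\<close> is not removed in between, so it would have coefficient at least 2 in a level,
  which is a coherent chain of degree at most \<open>n\<close>.\<close>

lemma coherent_count_le_1:
  "coherent K B c \<Longrightarrow> deg c \<le> int n \<Longrightarrow> count c (n, x) \<le> 1"
proof (induction n arbitrary: c x)
  case 0
  then have "homogeneous B 0 c"
    using deg_le_iff[of c 0] by (auto simp: homogeneous_def coherent_iff)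
  then have "size c = 1"
    using 0 chain_aug_eq_size by (auto simp: coherent_iff end_aug_def chain_face_id)
  then show ?case
    by (metis count_le_size)
next
  case (Suc n)
  from Suc.prems have chain: "is_chain B c"
    by (simp add: coherent_iff)
  obtain xs where xs: "mset xs = homog_part (Suc n) c"
    and sorted: "sorted_wrt (\<lambda>x y. (y, x) \<in> odot K B n \<longrightarrow> x = y) xs"
    using ex_topological_sorting[OF antisym_odot trans_odot] by blast
  have set: "y \<in> gens B \<and> fst y = Suc n" if "y \<in> set xs" for y
    using that homogeneous_homog_part[OF chain, of "Suc n"]
    by (auto simp: homogeneous_def is_chain_def simp flip: xs)
  show ?case
  proof (rule ccontr)
    assume "\<not> count c (Suc n, x) \<le> 1"
    then have "1 < count (mset xs) (Suc n, x)"
      by (simp add: xs count_homog_part)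
    then have "\<not> distinct xs"
      by (metis distinct_count_atmost_1 nat_neq_iff less_one not_less_zero less_irrefl)
    then obtain i j where ij: "i < j" "j < length xs" "xs ! i = xs ! j"
      by (metis distinct_conv_nth nat_neq_iff)
    define m where "m = length xs - 1"
    have len: "length xs = Suc m"
      using ij by (simp add: m_def)
    have gen: "xs ! k \<in> gens B" "fst (xs ! k) = Suc n" if "k \<le> m" for k
      using that set[of "xs ! k"] by (auto simp: len)
    interpret ordered_slices K B c n m "(!) xs"
    proof
      have "c = homog_part (Suc n) c + low_part (int n) c"
        using Suc.prems(2)
        by (intro chain_eqI)
          (auto simp: count_homog_part count_low_part deg_le_iff not_in_iff[symmetric] simp del: of_nat_Suc)
      also have "homog_part (Suc n) c = (\<Sum>i\<le>m. {#xs ! i#})"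
        using sum_nth_mset[of xs] xs by (simp add: len lessThan_Suc_atMost)
      finally show "c = (\<Sum>i\<le>m. {#xs ! i#}) + low_part (int n) c" .
      fix i j x
      assume "i < j" "j \<le> m" "face_coeff n {#xs ! j#} x < 0"
      \<comment> \<open>Entries related by \<open>odot\<close> may be copies of one generator; their
        flows then coincide and cannot have opposite signs.\<close>
      moreover from this have "(xs ! j, xs ! i) \<in> odot K B n \<Longrightarrow> xs ! i = xs ! j"
        using sorted by (simp add: sorted_wrt_iff_nth_less len)
      ultimately show "face_coeff n {#xs ! i#} x \<le> 0"
        using odot_if_flow[of "xs ! j" "xs ! i" n x] gen[of i] gen[of j] by fastforce
    qed (use chain gen in auto)
    have "i \<le> m" "j \<le> m"
      using ij by (auto simp: len)
    obtain x where "flow j x < 0"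
      unfolding flow_def
      using ex_negative_face_coeff[of "xs ! j" n] gen[OF \<open>j \<le> m\<close>] by auto
    then have "flow i x < 0"
      using ij by (simp add: flow_def)
    then have "1 \<le> level (Suc i) x"
      using count_slice_level_Suc[OF \<open>i \<le> m\<close>, of x] by linarith
    moreover have "level (Suc i) x \<le> level j x"
      using Suc_leI[OF ij(1)]
    proof (induction rule: dec_induct)
      case (step k)
      then show ?case
        using ordered[of k j x] \<open>j \<le> m\<close> \<open>flow j x < 0\<close> by (simp add: level_Suc flow_def)
    qed simp
    moreover have "level (Suc j) x \<le> 1"
      using Suc.IH[OF coherent_chain_face[OF coherent_slice[OF Suc.prems(1) \<open>j \<le> m\<close>]] deg_chain_face]
        count_chain_face_slice(2)[OF \<open>j \<le> m\<close>, of x]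
      by (metis of_nat_1 of_nat_le_iff)
    ultimately show False
      using \<open>flow j x < 0\<close> by (simp add: level_Suc)
  qed
qed

end


section \<open>The composition degree and the assembly of the theorem\<close>

lemma comp_deg_le:
  assumes "comp_deg a = int n" "y \<in># a" "z \<in># a" "y \<noteq> z"
  shows "fst y \<le> Suc n \<or> fst z \<le> Suc n"
proof (rule ccontr)
  assume *: "\<not> ?thesis"
  let ?P = "\<lambda>k :: int. \<exists>y\<in>set_mset a. \<exists>z\<in>set_mset a. y \<noteq> z \<and> fst y \<ge> fst z \<and> int (fst z) > k"
  let ?S = "insert (- 1) {k. k \<ge> - 1 \<and> ?P k}"
  \<comment> \<open>Two distinct elements of degree above \<open>n + 1\<close> put
    \<open>n + 1\<close> into the set whose supremum is \<open>comp_deg a\<close>. The definition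
    lists the element of larger degree first, hence the cases.\<close>
  have "?P (int (Suc n))"
  proof (cases "fst z \<le> fst y")
    case True
    then show ?thesis
      using * assms by (intro bexI[of _ y] bexI[of _ z]) auto
  next
    case False
    then show ?thesis
      using * assms by (intro bexI[of _ z] bexI[of _ y]) auto
  qed
  then have "int (Suc n) \<in> ?S"
    by simp
  \<comment> \<open>On \<open>int\<close> the supremum is an upper bound only for bounded sets; here
    the finitely many degrees in \<open>a\<close> provide the bound.\<close>
  moreover have "bdd_above ?S"
  proof (rule bdd_aboveI)
    fix k
    assume "k \<in> ?S"
    then consider "k = - 1" | z where "z \<in># a" "k < int (fst z)"
      by blast
    then show "k \<le> Max (insert (- 1) ((\<lambda>z. int (fst z)) ` set_mset a))"
    proof cases
      case 2
      then have "int (fst z) \<le> Max (insert (- 1) ((\<lambda>z. int (fst z)) ` set_mset a))"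
        by (intro Max_ge) auto
      then show ?thesis
        using 2 by linarith
    qed simp
  qed
  ultimately have "int (Suc n) \<le> comp_deg a"
    unfolding comp_deg_def by (rule cSup_upper)
  then show False
    using assms by simp
qed

theorem mainTheorem6:
  fixes K :: "'a adc" and B :: "nat \<Rightarrow> 'a set" and a :: "'a chain"
    and b :: "nat \<Rightarrow> nat \<times> 'a" and \<beta> :: "nat \<Rightarrow> 'a chain" and m n :: nat
  assumes "augmented_directed_complex K"
    and "adc_basis K B"
    and "unitary K B"
    and "loop_free K B"
    and "coherent K B a"
    and "comp_deg a = int n"
    and "ordered_form K B a m (\<lambda>_. 1) b"
    and "\<And>k. k \<le> m \<Longrightarrow> \<beta> k =
           {#b k#}
           + ((chain_face K B Minus n (\<Sum>i<k. {#b i#}) - chain_face K B Plus n {#b k#})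
              \<union># (chain_face K B Plus n (\<Sum>i\<in>{k<..m}. {#b i#}) - chain_face K B Minus n {#b k#}))
           + low_part (int n) a"
  shows "(\<forall>k\<le>m. coherent K B (\<beta> k)) \<and>
         (\<forall>k<m. chain_face K B Minus n (\<beta> k) = chain_face K B Plus n (\<beta> (Suc k))) \<and>
         mu_composite K B n \<beta> m = Some a"
proof -
  interpret unitary_loop_free_adc K B
    using assms(1-4)
    by (simp add: unitary_loop_free_adc_def based_adc_def unitary_loop_free_adc_axioms_def)
  have chain: "is_chain B a"
    using assms(5) by (simp add: coherent_iff)
  have decomp: "a = (\<Sum>i\<le>m. {#b i#}) + low_part (int n) a"
    and bij: "bij_betw b {0..m} {x \<in> set_mset a. int (fst x) > int n}"
    and order: "\<And>i j. i < j \<Longrightarrow> j \<le> m \<Longrightarrow> (b j, b i) \<notin> odot K B n"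
    using assms(7) by (simp_all add: ordered_form_def assms(6) atLeast0AtMost)
  have b: "b i \<in># a" "n < fst (b i)" "b i \<in> gens B" if "i \<le> m" for i
    using bij_betwE[OF bij] that chain by (auto simp: is_chain_def)
  interpret ordered_slices K B a n m b
  proof
    fix i j
    assume "i \<le> m" "j \<le> m" "i \<noteq> j"
    moreover from this have "b i \<noteq> b j"
      using bij by (auto simp: bij_betw_def inj_on_def)
    ultimately show "fst (b i) \<le> Suc n \<or> fst (b j) \<le> Suc n"
      using comp_deg_le[OF assms(6)] b by blast
  next
    fix i j x
    assume "i < j" "j \<le> m" "face_coeff n {#b j#} x < 0"
    \<comment> \<open>A positive flow of \<open>b i\<close> would relate \<open>b j\<close> to
      \<open>b i\<close> by \<open>odot\<close>, which the ordered form forbids.\<close>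
    then show "face_coeff n {#b i#} x \<le> 0"
      using odot_if_flow[of "b j" "b i" n x] order[of i j] b[of i] b[of j] by fastforce
  qed (use chain decomp b in auto)
  have \<beta>: "\<beta> k = slice k" if "k \<le> m" for k
    using assms(8)[OF that] by (simp add: slice_def)
  \<comment> \<open>This level is the degree \<open>n\<close> part of \<open>d_n^-\<close> of a
    coherent slice, itself coherent of degree at most \<open>n\<close>.\<close>
  have "level (Suc k) x \<le> 1" if "k \<le> m" for k x
    using coherent_count_le_1[OF coherent_chain_face[OF coherent_slice[OF assms(5) that]] deg_chain_face]
      count_chain_face_slice(2)[OF that, of x]
    by (metis of_nat_1 of_nat_le_iff)
  then have "mu_composite K B n slice m = Some a"
    using mu_composite_slices[OF assms(5), of m] partial_composite_m by simp
  \<comment> \<open>\<beta> is prescribed only up to \<open>m\<close>, so the composites are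
    compared by induction rather than by rewriting the function.\<close>
  moreover have "mu_composite K B n \<beta> k = mu_composite K B n slice k" if "k \<le> m" for k
    using that by (induction k) (simp_all add: \<beta>)
  ultimately show ?thesis
    using coherent_slice[OF assms(5)] slices_composable by (auto simp: \<beta>)
qed

end
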